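(* Let $N\ge 2$, $A\in\mathbb{R}^{n\times n}$, $B\in\mathbb{R}^{n\times m}$, where $(A,B)$ is stabilizable and all eigenvalues of $A$ lie in the closed left half complex plane. Let $\mathcal{G}$ be an undirected (possibly weighted) connected graph on $N$ vertices with Laplacian matrix $\mathcal{L}$, whose non-zero eigenvalues are $\lambda_2\le\lambda_3\le\cdots\le\lambda_N$. Let $\delta_{k,1}<\delta_{k,2}$ ($k=1,\ldots,m$) be real constants, and set $\Delta_1=\mathrm{diag}\{\delta_{k,1}\}_{k=1,\ldots,m}$, $\Delta_2=\mathrm{diag}\{\delta_{k,2}\}_{k=1,\ldots,m}$. Let $\epsilon>0$ be given. Suppose there exist matrices $X\in\mathbb{R}^{n\times n}$, $Y\in\mathbb{R}^{m\times n}$, $Z\in\mathbb{R}^{m\times m}$ with $X\succ0$, $Z\succ 0$ and $Z$ diagonal such that, for both $\lambda=\lambda_2$ and $\lambda=\lambda_N$, $$\begin{bmatrix} \mathrm{sym}(AX+\lambda B\Delta_{2}Y)+\epsilon X & BZ+\frac{1}{2}\lambda Y^T(\Delta_{1}-\Delta_{2}) \\ \left(BZ+\frac{1}{2}\lambda Y^T(\Delta_{1}-\Delta_{2})\right)^T & -Z \end{bmatrix} \preceq 0 .$$ Then, with the controller gain $\mathcal{K}=YX^{-1}\in\mathbb{R}^{m\times n}$, robust consensus is achieved: for all continuous functions $f_{i,k}:\mathbb{R}\to\mathbb{R}$ ($i=1,\ldots,N$, $k=1,\ldots,m$) satisfying $$(f_{i,k}(s)-\delta_{k,1}s)(f_{i,k}(s)-\delta_{k,2}s)\le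 0\quad\text{for all } s\in\mathbb{R},$$ and for every initial condition $x(0)\in\mathbb{R}^{nN}$, every solution $x(t)=[x_1(t)^T,\ldots,x_N(t)^T]^T$, $t\ge0$, of the closed-loop system $$\dot x=(I_N\otimes A)x+(I_N\otimes B)u,\qquad u=\mathbf{f}(z),\qquad z=(\mathcal{L}\otimes\mathcal{K})x,$$ satisfies $\lim_{t\to\infty}\|x_i(t)-x_j(t)\|=0$ for all $i,j=1,\ldots,N$.
   Context: $\mathrm{sym}(M)=M+M^T$ for a real square matrix $M$. $\succ,\succeq$ (resp. $\prec,\preceq$) denote positive (resp. negative) definiteness and semi-definiteness of symmetric matrices; in particular $X\succ 0$ includes that $X$ is symmetric. $\otimes$ is the Kronecker product and $I_N$ the $N\times N$ identity. Graph: the adjacency matrix has entries $a_{ij}\geq 0$, with $a_{ij}>0$ if and only if agent $i$ receives information from agent $j$; undirected means $a_{ij}=a_{ji}$ for all $i,j$. The Laplacian is $\mathcal{L}=\mathcal{D}-\mathcal{A}$ with $\mathcal{A}=(a_{ij})$ and $\mathcal{D}=\mathrm{diag}\{\sum_{j}a_{ij}\}_{i}$. Multi-agent system: each agent $i=1,\ldots,N$ has state $x_i\in\mathbb{R}^n$ and input $u_i\in\mathbb{R}^m$ with dynamics $\dot x_i=Ax_i+Bu_i$; $x$ and $u$ are the stacked vectors. For $z=[z_1^T,\ldots,z_N^T]^T$ with $z_i=[z_{i,1},\ldots,z_{i,m}]^T\in\mathbb{R}^m$, the nonlinearity acts componentwise: $\mathbf{f}(z)=[f_1(z_1)^T,\ldots,f_N(z_N)^T]^T$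 with $f_i(z_i)=[f_{i,1}(z_{i,1}),\ldots,f_{i,m}(z_{i,m})]^T$. *)

theory Defs
  imports "HOL-Analysis.Analysis" "HOL-Computational_Algebra.Polynomial"
begin

definition symm :: "real^'a^'a \<Rightarrow> real^'a^'a" where
  "symm M = M + transpose M"

definition pos_def :: "real^'a^'a \<Rightarrow> bool" where
  "pos_def M \<longleftrightarrow> transpose M = M \<and> (\<forall>v. v \<noteq> 0 \<longrightarrow> 0 < v \<bullet> (M *v v))"

definition neg_semidef :: "real^'a^'a \<Rightarrow> bool" where
  "neg_semidef M \<longleftrightarrow> transpose M = M \<and> (\<forall>v. v \<bullet> (M *v v) \<le> 0)"

definition diag :: "('a \<Rightarrow> real) \<Rightarrow> real^'a^'a" where
  "diag d = (\<chi> i j. if i = j then d i else 0)"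

definition diagonal :: "real^'a^'a \<Rightarrow> bool" where
  "diagonal M \<longleftrightarrow> (\<forall>i j. i \<noteq> j \<longrightarrow> M $ i $ j = 0)"

text \<open>The matrix with block rows \<open>P Q\<close> and \<open>R S\<close>.\<close>

definition block_matrix ::
  "real^'c^'r \<Rightarrow> real^'d^'r \<Rightarrow> real^'c^'s \<Rightarrow> real^'d^'s \<Rightarrow> real^('c + 'd)^('r + 's)" where
  "block_matrix P Q R S = (\<chi> i j.
     case i of
       Inl r \<Rightarrow> (case j of Inl c \<Rightarrow> P $ r $ c | Inr d \<Rightarrow> Q $ r $ d)
     | Inr s \<Rightarrow> (case j of Inl c \<Rightarrow> R $ s $ c | Inr d \<Rightarrow> S $ s $ d))"

text \<open>Rows and columns of a Kronecker product are indexed by pairs, so a stacked vector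
  \<open>x\<close> has the entries \<open>x $ (i, k)\<close>, where \<open>k\<close> is the position inside block \<open>i\<close>.\<close>

definition kron :: "real^'c^'r \<Rightarrow> real^'d^'s \<Rightarrow> real^('c \<times> 'd)^('r \<times> 's)" where
  "kron M P = (\<chi> p q. M $ fst p $ fst q * P $ snd p $ snd q)"

definition block_of :: "real^('a::finite \<times> 'b::finite) \<Rightarrow> 'a \<Rightarrow> real^'b" where
  "block_of x i = (\<chi> k. x $ (i, k))"

definition eigenvalue :: "'a::field^'n^'n \<Rightarrow> 'a \<Rightarrow> bool" where
  "eigenvalue M l \<longleftrightarrow> (\<exists>v. v \<noteq> 0 \<and> M *v v = l *s v)"

definition charpoly :: "'a::comm_ring_1^'n^'n \<Rightarrow> 'a poly" where
  "charpoly M = det (\<chi> i j. (if i = j then [:0, 1:] else 0) - [:M $ i $ j:])"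

text \<open>The eigenvalues in \<open>'a\<close>, counted with algebraic multiplicity.\<close>

definition eigenvalues_mset :: "'a::field^'n^'n \<Rightarrow> 'a multiset" where
  "eigenvalues_mset M = proots (charpoly M)"

lemma poly_charpoly: "poly (charpoly M) l = det (mat l - M)"
proof -
  have "poly (of_int k) l = of_int k" for k
    by (simp add: of_int_poly)
  moreover have "poly ((if i = j then [:0, 1:] else 0) - [:M $ i $ j:]) l = (mat l - M) $ i $ j" for i j
    by (simp add: mat_def)
  ultimately show ?thesis
    by (simp only: charpoly_def det_def poly_sum poly_prod poly_mult vec_lambda_beta)
qed

lemma eigenvalue_iff_root_charpoly:
  fixes M :: "'a::field^'b^'b"
  shows "eigenvalue M l \<longleftrightarrow> poly (charpoly M) l = 0"
proof -
  have ent: "(if i = j then l else 0) * c = (if i = j then l * c else 0)" for i j :: 'b and c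
    by simp
  have scal: "mat l *v v = l *s v" for v :: "'a^'b"
    by (simp add: vec_eq_iff matrix_vector_mult_def mat_def ent)
  have diff: "(mat l - M) *v v = mat l *v v - M *v v" for v
    by (rule matrix_vector_mult_diff_rdistrib)
  have "eigenvalue M l \<longleftrightarrow> (\<exists>v. (mat l - M) *v v = 0 \<and> v \<noteq> 0)"
    unfolding eigenvalue_def diff scal right_minus_eq by (metis (no_types))
  also have "\<dots> \<longleftrightarrow> \<not> (\<exists>B. B ** (mat l - M) = mat 1)"
    unfolding matrix_left_invertible_ker by blast
  also have "\<dots> \<longleftrightarrow> \<not> invertible (mat l - M)"
    unfolding invertible_left_inverse by (rule refl)
  also have "\<dots> \<longleftrightarrow> det (mat l - M) = 0"
    by (simp add: invertible_det_nz)
  finally show ?thesis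
    by (simp add: poly_charpoly)
qed

definition complex_matrix :: "real^'c^'r \<Rightarrow> complex^'c^'r" where
  "complex_matrix M = (\<chi> i j. complex_of_real (M $ i $ j))"

definition stabilizable :: "real^'n^'n \<Rightarrow> real^'m^'n \<Rightarrow> bool" where
  "stabilizable A B \<longleftrightarrow>
     (\<exists>F :: real^'n^'m. \<forall>l. eigenvalue (complex_matrix (A + B ** F)) l \<longrightarrow> Re l < 0)"

text \<open>A weighted graph is given by its adjacency matrix. Diagonal entries are left
  unconstrained; they cancel in the Laplacian.\<close>

definition undirected_graph :: "real^'N^'N \<Rightarrow> bool" where
  "undirected_graph a \<longleftrightarrow> (\<forall>i j. 0 \<le> a $ i $ j) \<and> (\<forall>i j. a $ i $ j = a $ j $ i)"

definition connected_graph :: "real^'N^'N \<Rightarrow> bool" where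
  "connected_graph a \<longleftrightarrow> (\<forall>i j. (i, j) \<in> {(i, j). 0 < a $ i $ j}\<^sup>*)"

definition laplacian :: "real^'N^'N \<Rightarrow> real^'N^'N" where
  "laplacian a = diag (\<lambda>i. \<Sum>j\<in>UNIV. a $ i $ j) - a"

definition in_sector :: "real \<Rightarrow> real \<Rightarrow> (real \<Rightarrow> real) \<Rightarrow> bool" where
  "in_sector d1 d2 g \<longleftrightarrow> (\<forall>s. (g s - d1 * s) * (g s - d2 * s) \<le> 0)"

definition nonlin :: "('N \<Rightarrow> 'm \<Rightarrow> real \<Rightarrow> real) \<Rightarrow> real^('N::finite \<times> 'm::finite) \<Rightarrow> real^('N \<times> 'm)" where
  "nonlin f z = (\<chi> p. f (fst p) (snd p) (z $ p))"

definition closed_loop_solution ::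
  "real^'n^'n \<Rightarrow> real^'m^'n \<Rightarrow> real^'N^'N \<Rightarrow> real^'n^'m \<Rightarrow> ('N \<Rightarrow> 'm \<Rightarrow> real \<Rightarrow> real)
     \<Rightarrow> (real \<Rightarrow> real^('N \<times> 'n)) \<Rightarrow> bool" where
  "closed_loop_solution A B L K f x \<longleftrightarrow>
     (\<forall>t\<ge>0. let z = kron L K *v x t; u = nonlin f z in
        (x has_vector_derivative
          (kron (mat 1 :: real^'N^'N) A *v x t + kron (mat 1 :: real^'N^'N) B *v u))
        (at t within {0..}))"

definition robust_consensus ::
  "real^'n^'n \<Rightarrow> real^'m^'n \<Rightarrow> real^'N^'N \<Rightarrow> ('m \<Rightarrow> real) \<Rightarrow> ('m \<Rightarrow> real) \<Rightarrow> real^'n^'m \<Rightarrow> bool" where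
  "robust_consensus A B L \<delta>1 \<delta>2 K \<longleftrightarrow>
     (\<forall>f. (\<forall>i k. continuous_on UNIV (f i k) \<and> in_sector (\<delta>1 k) (\<delta>2 k) (f i k)) \<longrightarrow>
       (\<forall>x0 x. x 0 = x0 \<and> closed_loop_solution A B L K f x \<longrightarrow>
         (\<forall>i j. ((\<lambda>t. norm (block_of (x t) i - block_of (x t) j)) \<longlongrightarrow> 0) at_top)))"

end

theory Submission
  imports Defs
begin

text \<open>Decompose the stacked state along an orthonormal eigenbasis \<open>E\<close> of the Laplacian and write
  \<open>x\<^sub>e\<close> for the component along \<open>e\<close>, and \<open>\<mu>\<^sub>e\<close> for the eigenvalue. By connectedness the agents agree
  exactly when \<open>x\<^sub>e = 0\<close> for all \<open>e\<close> with \<open>\<mu>\<^sub>e \<noteq> 0\<close>, and the Lyapunov function is the sum of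
  \<open>x\<^sub>e \<bullet> X\<inverse> x\<^sub>e\<close> over these \<open>e\<close>. The matrix inequality is affine in \<open>\<lambda>\<close>, so it holds at every
  nonzero \<open>\<mu>\<^sub>e\<close>; evaluated at \<open>(X\<inverse> x\<^sub>e, Z\<inverse> v\<^sub>e)\<close> with \<open>v = f(z) - \<Delta>\<^sub>2 z\<close>, it bounds the
  derivative by \<open>-\<epsilon>\<close> times the function plus terms quadratic in \<open>v\<^sub>e\<close> and \<open>z\<^sub>e\<close>. The sector condition
  is not diagonal in the modes, but summed over all modes these terms become, by Parseval, a sum over
  the agents that the sector condition makes nonpositive. The modes with \<open>\<mu>\<^sub>e = 0\<close> may be added
  to the sum because there \<open>z\<^sub>e = 0\<close> and the term is a positive multiple of \<open>v\<^sub>e\<^sup>2\<close>.\<close>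

subsection \<open>Orthonormal eigenbases of symmetric matrices\<close>

text \<open>For small \<open>t\<close> of sign opposite to \<open>b\<close> the linear term
  dominates the quadratic one. With \<open>d\<close> positive and larger than \<open>c\<close>, the
  value at \<open>t = - b / d\<close> is \<open>b^2 * (c - d) / d^2\<close>, which is negative
  unless \<open>b = 0\<close>.\<close>

lemma linear_coefficient_zero:
  fixes b c :: real
  assumes "\<And>t. 0 \<le> t * b + t\<^sup>2 * c"
  shows "b = 0"
proof (rule ccontr)
  assume "b \<noteq> 0"
  define d where "d = \<bar>c\<bar> + 1"
  have "d > 0" "c < d" by (auto simp: d_def)
  have "0 \<le> (- b / d) * b + (- b / d)\<^sup>2 * c" by (rule assms)
  also have "\<dots> = b\<^sup>2 * (c - d) / d\<^sup>2"
    using \<open>d > 0\<close> by (simp add: field_simps power2_eq_square)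
  also have "\<dots> < 0"
    using \<open>b \<noteq> 0\<close> \<open>c < d\<close> \<open>d > 0\<close> by (simp add: divide_neg_pos mult_pos_neg)
  finally show False by simp
qed

text \<open>A maximiser \<open>e\<close> of the Rayleigh quotient on the compact unit sphere of
  \<open>S\<close> is an eigenvector. By homogeneity, maximality on the sphere becomes the bound
  \<open>le\<close> on all of \<open>S\<close>, which can then be varied around
  \<open>e\<close>.\<close>

lemma self_adjoint_eigenvector:
  fixes f :: "'a::euclidean_space \<Rightarrow> 'a"
  assumes "linear f" and adj: "\<And>x y. f x \<bullet> y = x \<bullet> f y"
    and S: "subspace S" "f ` S \<subseteq> S" "S \<noteq> {0}"
  obtains e \<mu> where "e \<in> S" "norm e = 1" "f e = \<mu> *\<^sub>R e"
proof -
  interpret f: linear f by fact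
  obtain x0 where x0: "x0 \<in> S" "x0 \<noteq> 0"
    using S subspace_0 by blast
  have "x0 /\<^sub>R norm x0 \<in> sphere 0 1 \<inter> S"
    using x0 S by (auto intro: subspace_scale)
  moreover have "compact (sphere (0::'a) 1 \<inter> S)"
    using S by (simp add: closed_subspace compact_Int_closed)
  moreover have "continuous_on (sphere 0 1 \<inter> S) (\<lambda>x. x \<bullet> f x)"
    by (intro continuous_intros linear_continuous_on)
       (simp add: linear_conv_bounded_linear[symmetric] assms)
  ultimately obtain e where e: "e \<in> sphere 0 1 \<inter> S"
    and max: "\<And>y. y \<in> sphere 0 1 \<inter> S \<Longrightarrow> y \<bullet> f y \<le> e \<bullet> f e"
    by (metis continuous_attains_sup empty_iff)
  define \<mu> where "\<mu> = e \<bullet> f e"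
  have ee: "e \<bullet> e = 1" and eS: "e \<in> S"
    using e by (auto simp: norm_eq_1)
  have le: "x \<bullet> f x \<le> \<mu> * (x \<bullet> x)" if "x \<in> S" for x
  proof (cases "x = 0")
    case False
    have "x /\<^sub>R norm x \<in> sphere 0 1 \<inter> S"
      using False that S by (auto intro: subspace_scale)
    from max[OF this] False show ?thesis
      by (simp add: f.scaleR \<mu>_def dot_square_norm field_simps power2_eq_square)
  qed (simp add: f.zero)
  define y where "y = \<mu> *\<^sub>R e - f e"
  have yS: "y \<in> S"
    unfolding y_def using S eS by (blast intro: subspace_diff subspace_scale)
  \<comment> \<open>The gap in the bound \<open>le\<close> at \<open>e + t y\<close> has no constant
    term, since \<open>e\<close> attains equality. In the direction of the residual \<open>y\<close>
    its slope is twice the squared norm of \<open>y\<close>, so \<open>y\<close> must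
    vanish.\<close>
  have "0 \<le> t * (2 * (y \<bullet> y)) + t\<^sup>2 * (\<mu> * (y \<bullet> y) - y \<bullet> f y)" for t
  proof -
    have "e + t *\<^sub>R y \<in> S"
      using S eS yS by (blast intro: subspace_add subspace_scale)
    from le[OF this]
    have "0 \<le> \<mu> * ((e + t *\<^sub>R y) \<bullet> (e + t *\<^sub>R y)) - (e + t *\<^sub>R y) \<bullet> f (e + t *\<^sub>R y)"
      by simp
    also have "\<dots> = t * (2 * (\<mu> * (e \<bullet> y) - f e \<bullet> y)) + t\<^sup>2 * (\<mu> * (y \<bullet> y) - y \<bullet> f y)"
      using adj[of e y] adj[of y e]
      by (simp add: f.add f.scaleR inner_add inner_commute ee \<mu>_def algebra_simps power2_eq_square)
    also have "\<mu> * (e \<bullet> y) - f e \<bullet> y = y \<bullet> y"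
      by (simp add: y_def inner_diff_left)
    finally show ?thesis .
  qed
  then have "2 * (y \<bullet> y) = 0"
    by (rule linear_coefficient_zero)
  then have "f e = \<mu> *\<^sub>R e"
    by (simp add: y_def)
  with eS ee show ?thesis
    by (intro that) (auto simp: norm_eq_1)
qed

text \<open>Induction on the dimension of an invariant subspace: split off a unit eigenvector
  \<open>e\<close> and continue in the part of \<open>S\<close> orthogonal to \<open>e\<close>,
  which is again invariant because \<open>f\<close> is self-adjoint.\<close>

lemma self_adjoint_orthonormal_eigenbasis:
  fixes f :: "'a::euclidean_space \<Rightarrow> 'a"
  assumes "linear f" and adj: "\<And>x y. f x \<bullet> y = x \<bullet> f y"
    and "subspace S" "f ` S \<subseteq> S"
  shows "\<exists>E. pairwise orthogonal E \<and> span E = S \<and> (\<forall>e\<in>E. norm e = 1 \<and> (\<exists>\<mu>. f e = \<mu> *\<^sub>R e))"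
  using assms(3,4)
proof (induction "dim S" arbitrary: S rule: less_induct)
  case less
  show ?case
  proof (cases "S = {0}")
    case True
    then show ?thesis by (intro exI[of _ "{}"]) simp
  next
    case False
    interpret f: linear f by fact
    obtain e \<mu> where e: "e \<in> S" "norm e = 1" "f e = \<mu> *\<^sub>R e"
      using self_adjoint_eigenvector[OF assms(1) adj less.prems False] by metis
    define T where "T = S \<inter> {x. e \<bullet> x = 0}"
    have T: "subspace T"
      unfolding T_def using less.prems(1) subspace_hyperplane by (rule subspace_inter)
    have "f ` T \<subseteq> T"
      using less.prems(2) e(3) by (auto simp: T_def adj[symmetric])
    moreover have "dim T < dim S"
    proof -
      have "e \<notin> T" using e by (auto simp: T_def)
      then have "T \<subset> S" using e(1) unfolding T_def by blast
      then show ?thesis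
        using T less.prems(1) by (metis dim_psubset span_eq_iff)
    qed
    ultimately obtain E where E: "pairwise orthogonal E" "span E = T"
      "\<forall>e\<in>E. norm e = 1 \<and> (\<exists>\<mu>. f e = \<mu> *\<^sub>R e)"
      using less.hyps T by blast
    have ET: "E \<subseteq> T" using E span_superset by blast
    have "span (insert e E) = S"
    proof
      show "span (insert e E) \<subseteq> S"
        using ET e(1) less.prems(1) by (intro span_minimal) (auto simp: T_def)
      show "S \<subseteq> span (insert e E)"
      proof
        fix x assume "x \<in> S"
        then have "x - (e \<bullet> x) *\<^sub>R e \<in> T"
          using e less.prems(1)
          by (auto simp: T_def inner_diff_right norm_eq_1 intro: subspace_diff subspace_scale)
        then show "x \<in> span (insert e E)"
          using E(2) by (auto simp: span_insert)
      qed
    qed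
    moreover have "pairwise orthogonal (insert e E)"
      using E(1) ET by (intro pairwise_orthogonal_insert) (auto simp: T_def orthogonal_def)
    ultimately show ?thesis
      using e E(3) by (intro exI[of _ "insert e E"]) auto
  qed
qed

lemma inner_matrix_vector_transpose:
  fixes M :: "real^'c^'r"
  shows "x \<bullet> (M *v y) = (transpose M *v x) \<bullet> y"
  by (simp add: dot_lmul_matrix transpose_matrix_vector)

lemma symmetric_matrix_orthonormal_eigenbasis:
  fixes M :: "real^'a^'a"
  assumes "transpose M = M"
  obtains E \<mu> where "finite E" "pairwise orthogonal E" "\<And>e. e \<in> E \<Longrightarrow> norm e = 1"
    "span E = UNIV" "\<And>e. e \<in> E \<Longrightarrow> M *v e = \<mu> e *\<^sub>R e"
proof -
  have "\<exists>E. pairwise orthogonal E \<and> span E = UNIV \<and>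
      (\<forall>e\<in>E. norm e = 1 \<and> (\<exists>\<mu>. M *v e = \<mu> *\<^sub>R e))"
    by (rule self_adjoint_orthonormal_eigenbasis)
       (auto simp: inner_matrix_vector_transpose[of _ M] assms)
  then show ?thesis
    by (metis that pairwise_orthogonal_imp_finite)
qed

lemma orthonormal_Parseval:
  assumes "finite E" "pairwise orthogonal E" "\<And>e. e \<in> E \<Longrightarrow> norm e = 1" "span E = UNIV"
  shows "(\<Sum>e\<in>E. (e \<bullet> x) * (e \<bullet> y)) = x \<bullet> y"
proof -
  have "x \<bullet> y = (\<Sum>e\<in>E. (x \<bullet> e) *\<^sub>R e) \<bullet> y"
    using orthonormal_basis_expand[of E x] assms by simp
  then show ?thesis
    by (simp only: inner_sum_left inner_scaleR_left) (simp add: inner_commute)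
qed

subsection \<open>Graph Laplacians\<close>

text \<open>The factor 1/2 arises because each edge is counted in both directions. Symmetry of the
  weights identifies the sums with squares at the two ends of an edge.\<close>

lemma laplacian_quadratic_form:
  fixes a :: "real^'N^'N"
  assumes "undirected_graph a"
  shows "v \<bullet> (laplacian a *v v) = (\<Sum>i\<in>UNIV. \<Sum>j\<in>UNIV. a $ i $ j * (v $ i - v $ j)\<^sup>2) / 2"
proof -
  let ?s = "\<lambda>h. \<Sum>i\<in>UNIV. \<Sum>j\<in>UNIV. a $ i $ j * h i j"
  have sym: "a $ i $ j = a $ j $ i" for i j
    using assms by (simp add: undirected_graph_def)
  have "(laplacian a *v v) $ i = (\<Sum>j\<in>UNIV. a $ i $ j * v $ i) - (\<Sum>j\<in>UNIV. a $ i $ j * v $ j)" for i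
  proof -
    have "(laplacian a *v v) $ i
        = (\<Sum>j\<in>UNIV. (if i = j then (\<Sum>k\<in>UNIV. a $ i $ k) * v $ j else 0) - a $ i $ j * v $ j)"
      unfolding matrix_vector_mult_def laplacian_def diag_def
      by (auto intro!: sum.cong simp: algebra_simps)
    then show ?thesis
      by (simp add: sum_subtractf sum_distrib_right)
  qed
  then have form: "v \<bullet> (laplacian a *v v) = ?s (\<lambda>i j. v $ i * v $ i) - ?s (\<lambda>i j. v $ i * v $ j)"
    by (simp add: inner_vec_def sum_distrib_left right_diff_distrib sum_subtractf mult_ac)
  have "?s (\<lambda>i j. v $ j * v $ j) = ?s (\<lambda>i j. v $ i * v $ i)"
    by (subst sum.swap) (simp add: sym)
  then have "?s (\<lambda>i j. (v $ i - v $ j)\<^sup>2)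
      = 2 * ?s (\<lambda>i j. v $ i * v $ i) - 2 * ?s (\<lambda>i j. v $ i * v $ j)"
    by (simp add: power2_diff power2_eq_square algebra_simps sum.distrib sum_subtractf sum_distrib_left)
  with form show ?thesis by simp
qed

lemma laplacian_psd:
  assumes "undirected_graph a"
  shows "0 \<le> v \<bullet> (laplacian a *v v)"
  using assms by (auto simp: laplacian_quadratic_form undirected_graph_def intro!: sum_nonneg)

lemma laplacian_symmetric:
  assumes "undirected_graph a"
  shows "transpose (laplacian a) = laplacian a"
  using assms by (auto simp: undirected_graph_def transpose_def laplacian_def diag_def vec_eq_iff)

text \<open>On the kernel the quadratic form vanishes, and with it each of its nonnegative summands.
  Hence \<open>v\<close> agrees across every edge, and by induction along every path.\<close>

lemma laplacian_kernel_constant: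
  assumes a: "undirected_graph a" and "connected_graph a" and "laplacian a *v v = 0"
  shows "v $ i = v $ j"
proof -
  have nn: "0 \<le> a $ i $ j * (v $ i - v $ j)\<^sup>2" for i j
    using a by (simp add: undirected_graph_def)
  have "(\<Sum>i\<in>UNIV. \<Sum>j\<in>UNIV. a $ i $ j * (v $ i - v $ j)\<^sup>2) = 0"
    using laplacian_quadratic_form[OF a, of v] assms(3) by simp
  then have zero: "a $ i $ j * (v $ i - v $ j)\<^sup>2 = 0" for i j
    by (simp add: sum_nonneg_eq_0_iff nn sum_nonneg)
  have edge: "v $ i = v $ j" if "0 < a $ i $ j" for i j
    using zero[of i j] that by simp
  have "(i, j) \<in> {(i, j). 0 < a $ i $ j}\<^sup>*"
    using assms by (simp add: connected_graph_def)
  then show ?thesis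
    by (induction rule: rtrancl_induct) (auto dest: edge)
qed

text \<open>Membership in \<open>proots\<close> means being a root only for a nonzero polynomial.
  The characteristic polynomial is nonzero because a positive semidefinite matrix does not have the
  eigenvalue -1.\<close>

lemma laplacian_eigenvalue_in_mset:
  assumes "undirected_graph a" "eigenvalue (laplacian a) l"
  shows "l \<in># eigenvalues_mset (laplacian a)"
proof -
  have "\<not> eigenvalue (laplacian a) (- 1)"
  proof
    assume "eigenvalue (laplacian a) (- 1)"
    then obtain v where v: "v \<noteq> 0" "laplacian a *v v = - v"
      by (auto simp: eigenvalue_def scalar_mult_eq_scaleR)
    from laplacian_psd[OF assms(1), of v] v(2) have "v \<bullet> v \<le> 0"
      by simp
    with v(1) show False
      using inner_gt_zero_iff[of v] by linarith
  qed
  then have "charpoly (laplacian a) \<noteq> 0"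
    by (auto simp: eigenvalue_iff_root_charpoly)
  then show ?thesis
    using assms by (simp add: eigenvalues_mset_def eigenvalue_iff_root_charpoly)
qed

subsection \<open>The matrix inequality\<close>

lemma inner_block_matrix:
  fixes P :: "real^'r^'r" and Q :: "real^'s^'r" and R :: "real^'r^'s" and S :: "real^'s^'s"
  defines "join \<equiv> \<lambda>p q. \<chi> i. case i of Inl r \<Rightarrow> p $ r | Inr s \<Rightarrow> q $ s"
  shows "join p q \<bullet> (block_matrix P Q R S *v join p q)
    = p \<bullet> (P *v p) + p \<bullet> (Q *v q) + q \<bullet> (R *v p) + q \<bullet> (S *v q)"
proof -
  have sum_Plus: "(\<Sum>i\<in>UNIV. h i) = (\<Sum>i\<in>UNIV. h (Inl i)) + (\<Sum>i\<in>UNIV. h (Inr i))"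
    for h :: "'r + 's \<Rightarrow> real"
    unfolding UNIV_Plus_UNIV[symmetric] by (subst sum.Plus) auto
  show ?thesis
    unfolding join_def inner_vec_def matrix_vector_mult_def block_matrix_def
    by (simp add: sum_Plus sum.distrib distrib_left)
qed

lemma neg_semidef_block_matrixD:
  fixes P :: "real^'r^'r" and Q :: "real^'s^'r" and R :: "real^'s^'s"
  assumes "neg_semidef (block_matrix P Q (transpose Q) R)"
  shows "p \<bullet> (P *v p) + 2 * (p \<bullet> (Q *v q)) + q \<bullet> (R *v q) \<le> 0"
proof -
  have "p \<bullet> (Q *v q) = q \<bullet> (transpose Q *v p)"
    by (simp add: inner_matrix_vector_transpose[of p Q] inner_commute)
  then show ?thesis
    using assms inner_block_matrix[of p q P Q "transpose Q" R]
    unfolding neg_semidef_def by (metis (no_types, lifting) add.assoc mult_2)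
qed

lemma inner_symm: "p \<bullet> (symm M *v p) = 2 * (p \<bullet> (M *v p))"
  by (simp add: symm_def matrix_vector_mult_add_rdistrib inner_add_right
      inner_matrix_vector_transpose[of p M] inner_commute)

lemma diag_mult_vec: "diag d *v v = (\<chi> k. d k * v $ k)"
proof -
  have "(\<Sum>j\<in>UNIV. (if i = j then d i else 0) * v $ j) = (\<Sum>j\<in>UNIV. if i = j then d i * v $ j else 0)" for i
    by (rule sum.cong) auto
  then show ?thesis
    by (simp add: matrix_vector_mult_def diag_def vec_eq_iff)
qed

lemma diagonal_eq_diag:
  assumes "diagonal M"
  shows "M = diag (\<lambda>k. M $ k $ k)"
  using assms by (auto simp: diagonal_def diag_def vec_eq_iff)

lemma pos_def_diagonal_entry:
  assumes "pos_def M"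
  shows "0 < M $ k $ k"
proof -
  have "axis k (1::real) \<noteq> 0"
    by (simp add: axis_eq_0_iff)
  then have "0 < axis k 1 \<bullet> (M *v axis k 1)"
    using assms unfolding pos_def_def by blast
  then show ?thesis
    by (simp add: matrix_vector_mult_basis inner_axis' column_def)
qed

lemma matrix_inv_pos_def:
  assumes "pos_def X"
  shows "X ** matrix_inv X = mat 1"
proof -
  have "x = 0" if "X *v x = 0" for x
    using assms that unfolding pos_def_def by (metis inner_zero_right less_irrefl)
  then have "invertible X"
    unfolding invertible_left_inverse matrix_left_invertible_ker by blast
  then show ?thesis
    unfolding invertible_def matrix_inv_def by (rule someI2_ex) simp
qed

lemma matrix_inv_pos_def_vec:
  assumes "pos_def X"
  shows "X *v (matrix_inv X *v x) = x"
  by (simp add: matrix_vector_mul_assoc matrix_inv_pos_def[OF assms])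

lemma pos_def_inner_commute:
  assumes "pos_def X"
  shows "x \<bullet> (X *v y) = y \<bullet> (X *v x)"
  using assms inner_matrix_vector_transpose[of x X y] by (simp add: pos_def_def inner_commute)

lemma pos_def_nonneg:
  assumes "pos_def X"
  shows "0 \<le> x \<bullet> (X *v x)"
  using assms by (cases "x = 0") (auto simp: pos_def_def less_imp_le)

lemma matrix_inv_pos_def_inner_commute:
  assumes "pos_def X"
  shows "x \<bullet> (matrix_inv X *v y) = y \<bullet> (matrix_inv X *v x)"
  using pos_def_inner_commute[OF assms, of "matrix_inv X *v x" "matrix_inv X *v y"]
  by (simp add: matrix_inv_pos_def_vec[OF assms] inner_commute)

text \<open>This lets the Lyapunov function control the norm of the state. The constant
  \<open>c\<close> is a bound on the operator norm of \<open>X\<close>.\<close>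

lemma matrix_inv_pos_def_coercive:
  assumes "pos_def X"
  obtains c where "c > 0" "\<And>x. x \<bullet> x \<le> c * (x \<bullet> (matrix_inv X *v x))"
proof -
  obtain c where c: "c > 0" "\<And>x. norm (X *v x) \<le> norm x * c"
    using bounded_linear.pos_bounded[OF matrix_vector_mul_bounded_linear] by blast
  have "x \<bullet> x \<le> c * (x \<bullet> (matrix_inv X *v x))" for x
  proof -
    define p where "p = matrix_inv X *v x"
    have Xp: "X *v p = x"
      by (simp add: p_def matrix_inv_pos_def_vec[OF assms])
    have "x \<bullet> (X *v x) \<le> norm x * (norm x * c)"
      by (rule order_trans[OF norm_cauchy_schwarz mult_left_mono]) (auto simp: c)
    then have le: "x \<bullet> (X *v x) \<le> c * (x \<bullet> x)"
      by (simp add: dot_square_norm power2_eq_square mult_ac)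
    \<comment> \<open>With \<open>X p = x\<close>, expanding the form at \<open>c p - x\<close>
      produces both quantities to be compared. The bound \<open>le\<close> absorbs
      \<open>x \<bullet> (X *v x)\<close> into one of the two copies of
      \<open>c * (x \<bullet> x)\<close>, and a factor \<open>c\<close> cancels.\<close>
    have "0 \<le> (c *\<^sub>R p - x) \<bullet> (X *v (c *\<^sub>R p - x))"
      by (rule pos_def_nonneg[OF assms])
    also have "\<dots> = c\<^sup>2 * (p \<bullet> x) - 2 * c * (x \<bullet> x) + x \<bullet> (X *v x)"
      using pos_def_inner_commute[OF assms, of p x]
      by (simp add: matrix_vector_mult_diff_distrib matrix_scaleR_vector_ac
          flip: scaleR_matrix_vector_assoc)
         (simp add: Xp inner_diff algebra_simps power2_eq_square)
    also have "\<dots> \<le> c * (c * (p \<bullet> x) - x \<bullet> x)"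
      using le by (simp add: algebra_simps power2_eq_square)
    finally show ?thesis
      using c(1) by (simp add: zero_le_mult_iff inner_commute p_def)
  qed
  with c(1) show ?thesis by (rule that)
qed

lemma affine_nonpos_between:
  fixes p q :: real
  assumes "p + l1 * q \<le> 0" "p + l2 * q \<le> 0" "l1 \<le> l" "l \<le> l2"
  shows "p + l * q \<le> 0"
proof (cases "q \<ge> 0")
  case True
  then show ?thesis using assms mult_right_mono[of l l2 q] by linarith
next
  case False
  then show ?thesis using assms mult_right_mono_neg[of l1 l q] by linarith
qed

text \<open>The left side is the derivative of \<open>x \<bullet> (matrix_inv X *v x)\<close> along
  a single mode with Laplacian eigenvalue \<open>l\<close> and input perturbation \<open>v\<close>.
  The substitution \<open>p = matrix_inv X *v x\<close>, \<open>q = matrix_inv Z *v v\<close> turns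
  \<open>X p\<close>, \<open>Y p\<close> and \<open>Z q\<close> into \<open>x\<close>,
  \<open>K x\<close> and \<open>v\<close>, so that the block form becomes a statement about the
  closed loop.\<close>

lemma lmi_mode_dissipation:
  fixes A X :: "real^'n^'n" and B :: "real^'m^'n" and Y :: "real^'n^'m" and Z :: "real^'m^'m"
  assumes lmi: "\<And>l. l \<in> {l1, l2} \<Longrightarrow>
           neg_semidef (block_matrix
             (symm (A ** X + l *\<^sub>R (B ** diag \<delta>2 ** Y)) + \<epsilon> *\<^sub>R X)
             (B ** Z + (1/2 * l) *\<^sub>R (transpose Y ** (diag \<delta>1 - diag \<delta>2)))
             (transpose (B ** Z + (1/2 * l) *\<^sub>R (transpose Y ** (diag \<delta>1 - diag \<delta>2))))
             (- Z))"
    and l: "l1 \<le> l" "l \<le> l2"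
    and X: "pos_def X" and Z: "pos_def Z" "diagonal Z"
  defines "K \<equiv> Y ** matrix_inv X"
  shows "2 * ((matrix_inv X *v x) \<bullet> (A *v x + B *v (l *\<^sub>R (diag \<delta>2 *v (K *v x)) + v)))
    \<le> - \<epsilon> * (x \<bullet> (matrix_inv X *v x))
      + (\<Sum>k\<in>UNIV. ((v $ k)\<^sup>2 + (\<delta>2 k - \<delta>1 k) * (l *\<^sub>R (K *v x)) $ k * v $ k) / Z $ k $ k)"
proof -
  define p where "p = matrix_inv X *v x"
  define q where "q = (\<chi> k. v $ k / Z $ k $ k)"
  have Xp: "X *v p = x"
    by (simp add: p_def matrix_inv_pos_def_vec[OF X])
  have Yp: "Y *v p = K *v x"
    by (simp add: K_def p_def matrix_vector_mul_assoc)
  have pos: "0 < Z $ k $ k" for k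
    by (rule pos_def_diagonal_entry[OF Z(1)])
  have Zq: "Z *v q = v"
    using pos by (subst diagonal_eq_diag[OF Z(2)])
      (simp add: diag_mult_vec q_def vec_eq_iff less_imp_neq[symmetric])
  define D where "D = (\<Sum>k\<in>UNIV. (\<delta>1 k - \<delta>2 k) * (K *v x) $ k * v $ k / Z $ k $ k)"
  have D: "p \<bullet> (transpose Y ** (diag \<delta>1 - diag \<delta>2) *v q) = D"
  proof -
    have "p \<bullet> (transpose Y ** (diag \<delta>1 - diag \<delta>2) *v q) = (Y *v p) \<bullet> ((diag \<delta>1 - diag \<delta>2) *v q)"
      by (simp only: matrix_vector_mul_assoc[symmetric] inner_matrix_vector_transpose[of p "transpose Y"]
          transpose_transpose)
    also have "\<dots> = D"
      by (simp add: Yp matrix_vector_mult_diff_rdistrib diag_mult_vec inner_vec_def D_def q_def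
          algebra_simps diff_divide_distrib)
    finally show ?thesis .
  qed
  \<comment> \<open>For fixed \<open>p\<close> and \<open>q\<close> the block form with parameter
    \<open>l'\<close> equals \<open>c + l' * d\<close>, so its sign at the two endpoints decides
    every \<open>l\<close> between them. The factor 1/2 in front of the coupling \<open>D\<close>
    cancels because the two off-diagonal blocks contribute equally.\<close>
  define c where "c = 2 * (p \<bullet> (A *v x)) + \<epsilon> * (p \<bullet> x) + 2 * (p \<bullet> (B *v v)) - q \<bullet> v"
  define d where "d = 2 * (p \<bullet> (B *v (diag \<delta>2 *v (K *v x)))) + D"
  have "c + l' * d \<le> 0" if "l' \<in> {l1, l2}" for l'
  proof -
    let ?M = "A ** X + l' *\<^sub>R (B ** diag \<delta>2 ** Y)"
    have "?M *v p = A *v x + l' *\<^sub>R (B *v (diag \<delta>2 *v (K *v x)))"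
      by (simp only: matrix_vector_mult_add_rdistrib scaleR_matrix_vector_assoc[symmetric]
          matrix_vector_mul_assoc[symmetric] Xp Yp)
    then have "p \<bullet> ((symm ?M + \<epsilon> *\<^sub>R X) *v p)
        = 2 * (p \<bullet> (A *v x)) + 2 * l' * (p \<bullet> (B *v (diag \<delta>2 *v (K *v x)))) + \<epsilon> * (p \<bullet> x)"
      by (simp add: matrix_vector_mult_add_rdistrib[of "symm ?M"] inner_add_right inner_symm Xp
          flip: scaleR_matrix_vector_assoc)
    moreover have "p \<bullet> ((B ** Z + (1/2 * l') *\<^sub>R (transpose Y ** (diag \<delta>1 - diag \<delta>2))) *v q)
        = p \<bullet> (B *v v) + (1/2 * l') * D"
      by (simp only: matrix_vector_mult_add_rdistrib scaleR_matrix_vector_assoc[symmetric]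
          inner_add_right inner_scaleR_right D matrix_vector_mul_assoc[symmetric, of B] Zq)
    moreover have "q \<bullet> (- Z *v q) = - (q \<bullet> v)"
      using matrix_vector_mult_diff_rdistrib[of 0 Z q] by (simp add: Zq)
    ultimately show ?thesis
      using neg_semidef_block_matrixD[OF lmi[OF that], of p q]
      by (simp add: c_def d_def algebra_simps)
  qed
  then have "c + l * d \<le> 0"
    by (intro affine_nonpos_between[OF _ _ l]) auto
  moreover have "q \<bullet> v = (\<Sum>k\<in>UNIV. (v $ k)\<^sup>2 / Z $ k $ k)"
    by (simp add: q_def inner_vec_def power2_eq_square)
  moreover have "(\<Sum>k\<in>UNIV. (\<delta>2 k - \<delta>1 k) * (l *\<^sub>R (K *v x)) $ k * v $ k / Z $ k $ k) = - (l * D)"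
    unfolding D_def sum_distrib_left sum_negf[symmetric]
    by (rule sum.cong) (auto simp: algebra_simps minus_divide_left)
  moreover have "p \<bullet> (A *v x + B *v (l *\<^sub>R (diag \<delta>2 *v (K *v x)) + v))
      = p \<bullet> (A *v x) + (l * (p \<bullet> (B *v (diag \<delta>2 *v (K *v x)))) + p \<bullet> (B *v v))"
    by (simp only: matrix_vector_right_distrib inner_add_right inner_scaleR_right
        matrix_scaleR_vector_ac scaleR_matrix_vector_assoc[symmetric])
  ultimately show ?thesis
    unfolding p_def[symmetric] add_divide_distrib sum.distrib inner_commute[of x p]
    by (simp add: c_def d_def algebra_simps)
qed

subsection \<open>Modes of stacked vectors\<close>

text \<open>This is the Kronecker product of \<open>e\<close> transposed with the identity, applied
  to \<open>x\<close>. For \<open>e\<close> in an orthonormal basis it is the vector-valued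
  coefficient of \<open>x\<close> along \<open>e\<close>.\<close>

definition mode :: "real^'N \<Rightarrow> real^('N::finite \<times> 'b::finite) \<Rightarrow> real^'b" where
  "mode e x = (\<Sum>i\<in>UNIV. e $ i *\<^sub>R block_of x i)"

lemma mode_nth: "mode e x $ k = e \<bullet> (\<chi> i. x $ (i, k))"
  by (simp add: mode_def inner_vec_def block_of_def)

lemma linear_mode: "linear (mode e)"
proof (rule linearI)
  show "mode e (x + y) = mode e x + mode e y" for x y
    by (simp add: vec_eq_iff mode_nth inner_vec_def distrib_left sum.distrib)
  show "mode e (c *\<^sub>R x) = c *\<^sub>R mode e x" for c x
    by (simp add: vec_eq_iff mode_nth inner_vec_def sum_distrib_left mult.left_commute)
qed

lemma mode_scaleR_left: "mode (c *\<^sub>R e) x = c *\<^sub>R mode e x"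
  by (simp add: vec_eq_iff mode_nth)

lemma block_of_kron: "block_of (kron M P *v x) i = P *v (\<Sum>j\<in>UNIV. M $ i $ j *\<^sub>R block_of x j)"
proof (subst vec_eq_iff, rule allI)
  fix k
  have "block_of (kron M P *v x) i $ k = (\<Sum>(j, l)\<in>UNIV \<times> UNIV. M $ i $ j * P $ k $ l * x $ (j, l))"
    by (simp add: block_of_def kron_def matrix_vector_mult_def case_prod_beta)
  also have "\<dots> = (\<Sum>l\<in>UNIV. \<Sum>j\<in>UNIV. M $ i $ j * P $ k $ l * x $ (j, l))"
    by (subst sum.cartesian_product[symmetric]) (rule sum.swap)
  also have "\<dots> = (P *v (\<Sum>j\<in>UNIV. M $ i $ j *\<^sub>R block_of x j)) $ k"
    by (simp add: block_of_def matrix_vector_mult_def sum_distrib_left mult.assoc mult.left_commute)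
  finally show "block_of (kron M P *v x) i $ k = (P *v (\<Sum>j\<in>UNIV. M $ i $ j *\<^sub>R block_of x j)) $ k" .
qed

text \<open>The mixed-product rule for Kronecker products. When \<open>e\<close> is an eigenvector
  of a symmetric \<open>M\<close>, the graph factor becomes a scalar and the modes decouple.\<close>

lemma mode_kron: "mode e (kron M P *v x) = P *v mode (transpose M *v e) x"
proof -
  interpret P: linear "(*v) P" by (rule matrix_vector_mul_linear)
  have "mode e (kron M P *v x) = P *v (\<Sum>i\<in>UNIV. \<Sum>j\<in>UNIV. (e $ i * M $ i $ j) *\<^sub>R block_of x j)"
    by (simp only: mode_def block_of_kron P.sum P.scaleR scaleR_sum_right scaleR_scaleR)
  also have "(\<Sum>i\<in>UNIV. \<Sum>j\<in>UNIV. (e $ i * M $ i $ j) *\<^sub>R block_of x j) = mode (transpose M *v e) x"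
    by (subst sum.swap)
      (simp only: mode_def matrix_vector_mult_def transpose_def scaleR_sum_left vec_lambda_beta mult.commute)
  finally show ?thesis .
qed

text \<open>Entry \<open>k\<close> of the modes lists the coefficients of the vector of all agents'
  \<open>k\<close>-th entries, so Parseval holds for each \<open>k\<close> separately. This permits
  weights that vary with \<open>k\<close>.\<close>

lemma mode_Parseval:
  fixes x y :: "real^('N::finite \<times> 'b::finite)"
  assumes "finite E" "pairwise orthogonal E" "\<And>e. e \<in> E \<Longrightarrow> norm e = 1" "span E = (UNIV :: (real^'N) set)"
  shows "(\<Sum>e\<in>E. mode e x $ k * mode e y $ k) = (\<Sum>i\<in>UNIV. x $ (i, k) * y $ (i, k))"
  using orthonormal_Parseval[OF assms, of "\<chi> i. x $ (i, k)" "\<chi> i. y $ (i, k)"]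
  by (simp add: mode_nth) (simp add: inner_vec_def)

lemma block_of_mode_expansion:
  fixes x :: "real^('N::finite \<times> 'b::finite)"
  assumes "finite E" "pairwise orthogonal E" "\<And>e. e \<in> E \<Longrightarrow> norm e = 1" "span E = (UNIV :: (real^'N) set)"
  shows "block_of x i = (\<Sum>e\<in>E. e $ i *\<^sub>R mode e x)"
proof (subst vec_eq_iff, rule allI)
  fix k
  have "axis i 1 \<bullet> (\<chi> j. x $ (j, k)) = (\<Sum>e\<in>E. (e \<bullet> axis i 1) * (e \<bullet> (\<chi> j. x $ (j, k))))"
    by (rule orthonormal_Parseval[OF assms, symmetric])
  then show "block_of x i $ k = (\<Sum>e\<in>E. e $ i *\<^sub>R mode e x) $ k"
    by (simp add: block_of_def inner_axis inner_axis' mode_nth)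
qed

subsection \<open>Convergence of the closed loop\<close>

text \<open>The integrating factor \<open>exp (\<epsilon> * t)\<close> makes the differential
  inequality say that \<open>g\<close> is nonincreasing, which bounds \<open>V\<close> by a decaying
  exponential.\<close>

lemma exponential_decay_tendsto_0:
  fixes V :: "real \<Rightarrow> real"
  assumes der: "\<And>t. 0 \<le> t \<Longrightarrow> (V has_real_derivative V' t) (at t within {0..})"
    and le: "\<And>t. 0 \<le> t \<Longrightarrow> V' t \<le> - \<epsilon> * V t"
    and nonneg: "\<And>t. 0 \<le> t \<Longrightarrow> 0 \<le> V t" and "0 < \<epsilon>"
  shows "(V \<longlongrightarrow> 0) at_top"
proof (rule tendsto_sandwich)
  define g where "g t = exp (\<epsilon> * t) * V t" for t
  have g': "(g has_real_derivative exp (\<epsilon> * t) * (V' t + \<epsilon> * V t)) (at t within {0..})" if "0 \<le> t" for t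
  proof -
    have "((\<lambda>t. exp (\<epsilon> * t)) has_real_derivative exp (\<epsilon> * t) * \<epsilon>) (at t within {0..})"
      by (auto intro!: derivative_eq_intros)
    from DERIV_mult[OF this der[OF that]] show ?thesis
      by (simp add: g_def[abs_def] algebra_simps)
  qed
  have "g t \<le> g 0" if "0 \<le> t" for t
  \<comment> \<open>At 0 the derivative is known only one-sidedly. The sign is therefore used in the
    open interval, and continuity covers the endpoint.\<close>
  proof (rule DERIV_nonpos_imp_decreasing_open[OF that])
    fix s assume "0 < s" "s < t"
    then have "(g has_real_derivative exp (\<epsilon> * s) * (V' s + \<epsilon> * V s)) (at s)"
      using g'[of s] by (simp add: at_within_interior[of s "{0..}"])
    moreover have "exp (\<epsilon> * s) * (V' s + \<epsilon> * V s) \<le> 0"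
      using le[of s] \<open>0 < s\<close> by (simp add: mult_nonneg_nonpos)
    ultimately show "\<exists>y. DERIV g s :> y \<and> y \<le> 0" by blast
  next
    have "continuous_on {0..} g"
      by (rule DERIV_continuous_on) (use g' in auto)
    then show "continuous_on {0..t} g"
      by (rule continuous_on_subset) auto
  qed
  then have g_le: "g t \<le> g 0" if "0 \<le> t" for t
    using that by blast
  have "V t \<le> V 0 * exp (- (\<epsilon> * t))" if "0 \<le> t" for t
  proof -
    have "exp (- (\<epsilon> * t)) * g t \<le> exp (- (\<epsilon> * t)) * g 0"
      using g_le[OF that] by simp
    moreover have "exp (- (\<epsilon> * t)) * g t = V t"
      unfolding g_def mult.assoc[symmetric] exp_add[symmetric] by simp
    moreover have "exp (- (\<epsilon> * t)) * g 0 = V 0 * exp (- (\<epsilon> * t))"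
      by (simp add: g_def)
    ultimately show ?thesis
      by (simp only:)
  qed
  then show "\<forall>\<^sub>F t in at_top. V t \<le> V 0 * exp (- (\<epsilon> * t))"
    by (auto intro: eventually_at_top_linorderI[of 0])
  show "\<forall>\<^sub>F t in at_top. 0 \<le> V t"
    using nonneg by (auto intro: eventually_at_top_linorderI[of 0])
  have "LIM t at_top. \<epsilon> * t :> at_top"
    using \<open>0 < \<epsilon>\<close> by (intro filterlim_tendsto_pos_mult_at_top[OF tendsto_const] filterlim_ident)
  then have "((\<lambda>t. exp (- (\<epsilon> * t))) \<longlongrightarrow> 0) at_top"
    by (rule filterlim_compose[OF exp_at_bot filterlim_compose[OF filterlim_uminus_at_bot_at_top]])
  then show "((\<lambda>t. V 0 * exp (- (\<epsilon> * t))) \<longlongrightarrow> 0) at_top"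
    using tendsto_mult_right_zero by blast
qed auto

text \<open>The weights and sector bounds depend only on the channel \<open>k\<close>, so they come
  out of the sum over modes, and Parseval applies inside.\<close>

lemma sector_modes_sum_nonpos:
  fixes z :: "real^('N::finite \<times> 'm::finite)"
  assumes E: "finite E" "pairwise orthogonal E" "\<And>e. e \<in> E \<Longrightarrow> norm e = 1" "span E = (UNIV :: (real^'N) set)"
    and sector: "\<And>i k. in_sector (\<delta>1 k) (\<delta>2 k) (f i k)" and w: "\<And>k. 0 < w k"
  defines "v \<equiv> \<chi> p. nonlin f z $ p - \<delta>2 (snd p) * z $ p"
  shows "(\<Sum>e\<in>E. \<Sum>k\<in>UNIV. ((mode e v $ k)\<^sup>2 + (\<delta>2 k - \<delta>1 k) * mode e z $ k * mode e v $ k) / w k) \<le> 0"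
proof -
  have "(\<Sum>e\<in>E. \<Sum>k\<in>UNIV. ((mode e v $ k)\<^sup>2 + (\<delta>2 k - \<delta>1 k) * mode e z $ k * mode e v $ k) / w k)
    = (\<Sum>k\<in>UNIV. ((\<Sum>e\<in>E. mode e v $ k * mode e v $ k)
        + (\<delta>2 k - \<delta>1 k) * (\<Sum>e\<in>E. mode e z $ k * mode e v $ k)) / w k)"
    by (subst sum.swap) (simp add: sum.distrib sum_distrib_left power2_eq_square mult.assoc
        flip: sum_divide_distrib)
  also have "\<dots> = (\<Sum>k\<in>UNIV. (\<Sum>i\<in>UNIV. v $ (i, k) * v $ (i, k) + (\<delta>2 k - \<delta>1 k) * (z $ (i, k) * v $ (i, k))) / w k)"
    by (simp add: mode_Parseval[OF E] sum.distrib sum_distrib_left)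
  also have "\<dots> \<le> 0"
  proof (intro sum_nonpos divide_nonpos_pos w)
    fix k i
    \<comment> \<open>Since \<open>v\<close> is \<open>f(z) - \<delta>2 z\<close>, adding
      \<open>(\<delta>2 - \<delta>1) z\<close> gives \<open>f(z) - \<delta>1 z\<close>. The summand
      below is thus exactly this sector product.\<close>
    have "(f i k (z $ (i, k)) - \<delta>1 k * z $ (i, k)) * (f i k (z $ (i, k)) - \<delta>2 k * z $ (i, k)) \<le> 0"
      using sector[of k i] unfolding in_sector_def by blast
    then show "v $ (i, k) * v $ (i, k) + (\<delta>2 k - \<delta>1 k) * (z $ (i, k) * v $ (i, k)) \<le> 0"
      by (simp add: v_def nonlin_def algebra_simps)
  qed
  finally show ?thesis .
qed

text \<open>Loop shifting: the linear gain \<open>d\<close> is split off from \<open>u\<close>,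
  leaving a remainder. The split passes to modes because \<open>d\<close> varies with the channel
  but not with the agent.\<close>

lemma mode_shifted_nonlinearity:
  fixes u z :: "real^('N::finite \<times> 'm::finite)"
  shows "mode e u = diag d *v mode e z + mode e (\<chi> p. u $ p - d (snd p) * z $ p)"
  by (simp add: vec_eq_iff diag_mult_vec mode_nth inner_vec_def sum_distrib_left
      algebra_simps flip: sum.distrib)

theorem theorem1:
  fixes A :: "real^'n^'n" and B :: "real^'m^'n"
    and a :: "real^'N^'N" and lam :: "nat \<Rightarrow> real"
    and \<delta>1 \<delta>2 :: "'m \<Rightarrow> real" and \<epsilon> :: real
    and X :: "real^'n^'n" and Y :: "real^'n^'m" and Z :: "real^'m^'m"
  assumes "CARD('N) \<ge> 2"
    and "stabilizable A B"
    and "\<And>l. eigenvalue (complex_matrix A) l \<Longrightarrow> Re l \<le> 0"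
    and "undirected_graph a" and "connected_graph a"
    and "mono_on {2..CARD('N)} lam"
    and "image_mset lam (mset_set {2..CARD('N)})
           = filter_mset (\<lambda>l. l \<noteq> 0) (eigenvalues_mset (laplacian a))"
    and "\<And>k. \<delta>1 k < \<delta>2 k"
    and "\<epsilon> > 0"
    and "pos_def X" and "pos_def Z" and "diagonal Z"
    and "\<And>l. l \<in> {lam 2, lam CARD('N)} \<Longrightarrow>
           neg_semidef (block_matrix
             (symm (A ** X + l *\<^sub>R (B ** diag \<delta>2 ** Y)) + \<epsilon> *\<^sub>R X)
             (B ** Z + (1/2 * l) *\<^sub>R (transpose Y ** (diag \<delta>1 - diag \<delta>2)))
             (transpose (B ** Z + (1/2 * l) *\<^sub>R (transpose Y ** (diag \<delta>1 - diag \<delta>2))))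
             (- Z))"
  shows "robust_consensus A B (laplacian a) \<delta>1 \<delta>2 (Y ** matrix_inv X)"
proof -
  define K where "K = Y ** matrix_inv X"
  let ?L = "laplacian a" and ?P = "matrix_inv X"
  have "((\<lambda>t. norm (block_of (x t) i - block_of (x t) j)) \<longlongrightarrow> 0) at_top"
    if sector: "\<And>i k. in_sector (\<delta>1 k) (\<delta>2 k) (f i k)"
      and sol: "closed_loop_solution A B ?L K f x" for f x and i j :: 'N
  proof -
    have sym: "transpose ?L = ?L"
      using assms(4) by (rule laplacian_symmetric)
    obtain E \<mu> where E: "finite E" "pairwise orthogonal E" "\<And>e. e \<in> E \<Longrightarrow> norm e = 1"
        "span E = (UNIV :: (real^'N) set)"
      and \<mu>: "\<And>e. e \<in> E \<Longrightarrow> ?L *v e = \<mu> e *\<^sub>R e"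
      using symmetric_matrix_orthonormal_eigenbasis[OF sym] by metis
    define E' where "E' = {e \<in> E. \<mu> e \<noteq> 0}"
    \<comment> \<open>A nonzero \<open>\<mu> e\<close> occurs in the sorted list \<open>lam\<close>
      of nonzero Laplacian eigenvalues, so monotonicity places it between the first and the
      last.\<close>
    have \<mu>_range: "lam 2 \<le> \<mu> e \<and> \<mu> e \<le> lam CARD('N)" if "e \<in> E'" for e
    proof -
      have e: "e \<in> E" "\<mu> e \<noteq> 0" using that by (auto simp: E'_def)
      then have "e \<noteq> 0" using E(3) by fastforce
      then have "eigenvalue ?L (\<mu> e)"
        using \<mu>[OF e(1)] by (auto simp: eigenvalue_def scalar_mult_eq_scaleR)
      then have "\<mu> e \<in># image_mset lam (mset_set {2..CARD('N)})"
        using laplacian_eigenvalue_in_mset[OF assms(4)] e(2) by (simp add: assms(7))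
      then obtain r where "r \<in> {2..CARD('N)}" "\<mu> e = lam r"
        by auto
      then show ?thesis
        using mono_onD[OF assms(6), of 2 r] mono_onD[OF assms(6), of r "CARD('N)"] by auto
    qed
    define z where "z t = kron ?L K *v x t" for t
    define F where "F t = kron (mat 1 :: real^'N^'N) A *v x t
        + kron (mat 1 :: real^'N^'N) B *v nonlin f (z t)" for t
    have x': "(x has_vector_derivative F t) (at t within {0..})" if "0 \<le> t" for t
      using sol that by (simp add: closed_loop_solution_def F_def z_def Let_def)
    define v where "v t = (\<chi> p. nonlin f (z t) $ p - \<delta>2 (snd p) * z t $ p)" for t
    have mode_z: "mode e (z t) = \<mu> e *\<^sub>R (K *v mode e (x t))" if "e \<in> E" for e t
      by (simp add: z_def mode_kron sym \<mu>[OF that] mode_scaleR_left matrix_scaleR_vector_ac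
          flip: scaleR_matrix_vector_assoc)
    have mode_F: "mode e (F t) = A *v mode e (x t)
        + B *v (\<mu> e *\<^sub>R (diag \<delta>2 *v (K *v mode e (x t))) + mode e (v t))" if "e \<in> E" for e t
    proof -
      have "mode e (F t) = A *v mode e (x t) + B *v mode e (nonlin f (z t))"
        by (simp add: F_def linear_add[OF linear_mode] mode_kron)
      also have "mode e (nonlin f (z t)) = \<mu> e *\<^sub>R (diag \<delta>2 *v (K *v mode e (x t))) + mode e (v t)"
        unfolding mode_shifted_nonlinearity[of e "nonlin f (z t)" \<delta>2 "z t"] v_def
        by (simp add: mode_z[OF that] matrix_scaleR_vector_ac flip: scaleR_matrix_vector_assoc)
      finally show ?thesis .
    qed
    \<comment> \<open>The remainder that \<open>lmi_mode_dissipation\<close> leaves for the mode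
      \<open>e\<close>, with \<open>mode e (z t)\<close> in place of \<open>\<mu> e\<close> times
      \<open>K\<close> applied to the state mode.\<close>
    define q where "q t e = (\<Sum>k\<in>UNIV. ((mode e (v t) $ k)\<^sup>2
        + (\<delta>2 k - \<delta>1 k) * mode e (z t) $ k * mode e (v t) $ k) / Z $ k $ k)" for t e
    have Zpos: "0 < Z $ k $ k" for k
      by (rule pos_def_diagonal_entry[OF assms(11)])
    have q: "sum (q t) E' \<le> 0" for t
    proof -
      have "0 \<le> q t e" if "e \<in> E - E'" for e
        using that Zpos by (auto simp: E'_def q_def mode_z intro!: sum_nonneg divide_nonneg_pos)
      then have "sum (q t) E' \<le> sum (q t) E"
        using E(1) by (intro sum_mono2) (auto simp: E'_def)
      also have "\<dots> \<le> 0"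
        unfolding q_def v_def by (rule sector_modes_sum_nonpos[OF E sector Zpos])
      finally show ?thesis .
    qed
    define V where "V t = (\<Sum>e\<in>E'. mode e (x t) \<bullet> (?P *v mode e (x t)))" for t
    define V' where "V' t = (\<Sum>e\<in>E'. 2 * ((?P *v mode e (x t)) \<bullet> mode e (F t)))" for t
    have P_nonneg: "0 \<le> y \<bullet> (?P *v y)" for y
      using pos_def_nonneg[OF assms(10), of "?P *v y"]
      by (simp add: matrix_inv_pos_def_vec[OF assms(10)] inner_commute)
    have "(V has_real_derivative V' t) (at t within {0..})" if "0 \<le> t" for t
      unfolding V_def[abs_def] V'_def
    proof (rule DERIV_sum)
      fix e
      have "((\<lambda>t. mode e (x t)) has_vector_derivative mode e (F t)) (at t within {0..})"
        by (rule bounded_linear.has_vector_derivative[OF linear_mode[unfolded linear_conv_bounded_linear] x'[OF that]])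
      \<comment> \<open>The product rule gives two terms, which coincide by symmetry of the inverse
        of \<open>X\<close>; hence the factor 2 in \<open>V'\<close>.\<close>
      note bounded_bilinear.has_vector_derivative[OF bounded_bilinear_inner this
          bounded_linear.has_vector_derivative[OF matrix_vector_mul_bounded_linear[of ?P] this]]
      then show "((\<lambda>t. mode e (x t) \<bullet> (?P *v mode e (x t))) has_real_derivative
          2 * ((?P *v mode e (x t)) \<bullet> mode e (F t))) (at t within {0..})"
        by (simp add: has_real_derivative_iff_has_vector_derivative inner_commute[of "?P *v mode e (x t)"]
            matrix_inv_pos_def_inner_commute[OF assms(10), of "mode e (x t)"])
    qed
    moreover have "V' t \<le> - \<epsilon> * V t" for t
    proof -
      have "V' t \<le> (\<Sum>e\<in>E'. - \<epsilon> * (mode e (x t) \<bullet> (?P *v mode e (x t))) + q t e)"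
        unfolding V'_def
      proof (rule sum_mono)
        fix e assume e: "e \<in> E'"
        then have "e \<in> E" by (simp add: E'_def)
        show "2 * ((?P *v mode e (x t)) \<bullet> mode e (F t))
            \<le> - \<epsilon> * (mode e (x t) \<bullet> (?P *v mode e (x t))) + q t e"
          using lmi_mode_dissipation[OF assms(13) conjunct1[OF \<mu>_range[OF e]] conjunct2[OF \<mu>_range[OF e]]
              assms(10-12), where x = "mode e (x t)" and v = "mode e (v t)"]
          by (simp only: mode_F[OF \<open>e \<in> E\<close>] q_def mode_z[OF \<open>e \<in> E\<close>] K_def)
      qed
      also have "\<dots> \<le> - \<epsilon> * V t"
        using q[of t] unfolding V_def sum.distrib sum_distrib_left by linarith
      finally show ?thesis .
    qed
    ultimately have V: "(V \<longlongrightarrow> 0) at_top"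
      using exponential_decay_tendsto_0[of V V' \<epsilon>] assms(9) P_nonneg
      by (simp add: V_def sum_nonneg)
    obtain c where c: "c > 0" "\<And>y. y \<bullet> y \<le> c * (y \<bullet> (?P *v y))"
      using matrix_inv_pos_def_coercive[OF assms(10)] by blast
    have mode_lim: "((\<lambda>t. mode e (x t)) \<longlongrightarrow> 0) at_top" if "e \<in> E'" for e
    proof -
      have "(norm (mode e (x t)))\<^sup>2 \<le> c * V t" for t
      proof -
        have "mode e (x t) \<bullet> (?P *v mode e (x t)) \<le> V t"
          unfolding V_def using that E(1) P_nonneg by (intro member_le_sum) (auto simp: E'_def)
        then have "c * (mode e (x t) \<bullet> (?P *v mode e (x t))) \<le> c * V t"
          using c(1) by simp
        then show ?thesis
          using c(2)[of "mode e (x t)"] unfolding power2_norm_eq_inner by linarith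
      qed
      moreover have "((\<lambda>t. c * V t) \<longlongrightarrow> 0) at_top"
        using V by (rule tendsto_mult_right_zero)
      ultimately have "((\<lambda>t. (norm (mode e (x t)))\<^sup>2) \<longlongrightarrow> 0) at_top"
        using tendsto_sandwich[OF _ _ tendsto_const, of 0 "\<lambda>t. (norm (mode e (x t)))\<^sup>2" at_top "\<lambda>t. c * V t"]
        by simp
      from tendsto_real_sqrt[OF this] show ?thesis
        by (simp add: tendsto_norm_zero_iff)
    qed
    have "block_of (x t) i - block_of (x t) j = (\<Sum>e\<in>E'. (e $ i - e $ j) *\<^sub>R mode e (x t))" for t
    proof -
      \<comment> \<open>Eigenvectors with eigenvalue zero are constant over the connected graph, so
        their modes cancel in the difference of two agents and only decaying modes remain.\<close>
      have "e $ i = e $ j" if "e \<in> E - E'" for e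
        using that \<mu>[of e] by (intro laplacian_kernel_constant[OF assms(4,5)]) (auto simp: E'_def)
      then have "(\<Sum>e\<in>E. (e $ i - e $ j) *\<^sub>R mode e (x t)) = (\<Sum>e\<in>E'. (e $ i - e $ j) *\<^sub>R mode e (x t))"
        using E(1) by (intro sum.mono_neutral_right) (auto simp: E'_def)
      then show ?thesis
        by (simp add: block_of_mode_expansion[OF E] sum_subtractf scaleR_left_diff_distrib)
    qed
    moreover have "((\<lambda>t. \<Sum>e\<in>E'. (e $ i - e $ j) *\<^sub>R mode e (x t)) \<longlongrightarrow> (\<Sum>e\<in>E'. (e $ i - e $ j) *\<^sub>R 0)) at_top"
      by (intro tendsto_sum tendsto_scaleR tendsto_const mode_lim)
    ultimately show ?thesis
      by (simp add: tendsto_norm_zero)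
  qed
  then show ?thesis
    unfolding robust_consensus_def K_def by blast
qed

end
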